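(* Suppose $\alpha\in(0,1]$ and $\phi\in C^{0,\alpha}(I)$. There exists $u_\phi\in C^{0,\alpha}(I)$ satisfying the functional equation $$u_\phi(x)=\sup_{n\in\mathbb{N}}\Bigl\{\overline{\phi}\Bigl(\frac{1}{n+x}\Bigr)+u_\phi\Bigl(\frac{1}{n+x}\Bigr)\Bigr\}\quad\text{for all }x\in I,$$ where $\overline{\phi}=\phi-Q(G,\phi)$.
   Context: $I=[0,1]$; the Gauss map $G:I\to I$ is $G(x)=\frac1x-\lfloor\frac1x\rfloor$ for $x\in(0,1]$ and $G(0)=0$. $\mathcal{M}(I,G)$ is the set of $G$-invariant Borel probability measures on $I$, and $Q(G,\phi)=\sup_{\mu\in\mathcal{M}(I,G)}\int\phi\,d\mu$. $C^{0,\alpha}(I)$ is the space of real-valued $\alpha$-Hölder functions on $I$ (Euclidean metric). $\mathbb{N}=\{1,2,\dots\}$. *)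

theory Defs
  imports "HOL-Probability.Probability"
begin

definition gauss_map :: "real \<Rightarrow> real" where
  "gauss_map x = (if x = 0 then 0 else 1 / x - of_int \<lfloor>1 / x\<rfloor>)"

abbreviation borel_I :: "real measure" where
  "borel_I \<equiv> restrict_space borel {0..1}"

definition invariant_measures :: "(real \<Rightarrow> real) \<Rightarrow> real measure set" where
  "invariant_measures T =
     {\<mu>. sets \<mu> = sets borel_I \<and> prob_space \<mu> \<and> T \<in> measurable \<mu> \<mu> \<and> distr \<mu> \<mu> T = \<mu>}"

text \<open>Only the values of \<open>\<phi>\<close> on the unit interval matter, since every measure in
  \<open>invariant_measures T\<close> has the unit interval as its space. The supremum is the one of the
  conditionally complete lattice of real numbers; the lemmas below show that for the Gauss map and
  a Hoelder function the set of integrals is nonempty and bounded above.\<close>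

definition max_ergodic_average :: "(real \<Rightarrow> real) \<Rightarrow> (real \<Rightarrow> real) \<Rightarrow> real" where
  "max_ergodic_average T \<phi> = (SUP \<mu>\<in>invariant_measures T. integral\<^sup>L \<mu> \<phi>)"

definition holder_on :: "real \<Rightarrow> real set \<Rightarrow> (real \<Rightarrow> real) \<Rightarrow> bool" where
  "holder_on \<alpha> S f \<longleftrightarrow>
     (\<exists>C\<ge>0. \<forall>x\<in>S. \<forall>y\<in>S. \<bar>f x - f y\<bar> \<le> C * \<bar>x - y\<bar> powr \<alpha>)"

lemma gauss_map_in_I: "gauss_map x \<in> {0..1}"
proof -
  have "0 \<le> frac (1 / x)" "frac (1 / x) \<le> 1"
    using frac_lt_1[of "1 / x"] by auto
  then show ?thesis
    by (simp add: gauss_map_def frac_def)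
qed

lemma gauss_map_measurable: "gauss_map \<in> measurable borel_I borel_I"
proof (rule measurable_restrict_space2)
  show "gauss_map \<in> space borel_I \<rightarrow> {0..1}"
    using gauss_map_in_I by blast
  have "gauss_map \<in> borel_measurable borel"
    unfolding gauss_map_def by measurable
  then show "gauss_map \<in> borel_measurable borel_I"
    by (rule measurable_restrict_space1)
qed

lemma invariant_measures_gauss_nonempty: "invariant_measures gauss_map \<noteq> {}"
proof -
  let ?R = "return borel_I (0::real)"
  have m: "gauss_map \<in> measurable ?R ?R"
    using gauss_map_measurable measurable_cong_sets[of ?R borel_I ?R borel_I] by simp
  have z: "(0::real) \<in> space borel_I"
    by (simp add: space_restrict_space)
  have "distr ?R ?R gauss_map = distr ?R borel_I gauss_map"
    by (rule distr_cong) simp_all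
  also have "\<dots> = return borel_I (gauss_map 0)"
    by (rule distr_return[OF gauss_map_measurable z])
  also have "\<dots> = ?R"
    by (simp add: gauss_map_def)
  finally have "?R \<in> invariant_measures gauss_map"
    using m prob_space_return[OF z] by (simp add: invariant_measures_def)
  then show ?thesis by blast
qed

lemma holder_on_bounded:
  assumes "0 < \<alpha>" "holder_on \<alpha> {0..1} f"
  obtains B where "\<And>x. x \<in> {0..1} \<Longrightarrow> \<bar>f x\<bar> \<le> B"
proof -
  obtain C where C: "C \<ge> 0"
    "\<And>x y. x \<in> {0..1} \<Longrightarrow> y \<in> {0..1} \<Longrightarrow> \<bar>f x - f y\<bar> \<le> C * \<bar>x - y\<bar> powr \<alpha>"
    using assms(2) unfolding holder_on_def by blast
  show ?thesis
  proof (rule that)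
    fix x :: real assume x: "x \<in> {0..1}"
    have "\<bar>x - 0\<bar> powr \<alpha> \<le> 1 powr \<alpha>"
      using x assms(1) by (intro powr_mono2) auto
    then have "C * \<bar>x - 0\<bar> powr \<alpha> \<le> C"
      using C(1) mult_left_mono[of "\<bar>x - 0\<bar> powr \<alpha>" 1 C] by simp
    with C(2)[OF x, of 0] show "\<bar>f x\<bar> \<le> C + \<bar>f 0\<bar>"
      by simp
  qed
qed

lemma integrals_bdd_above:
  assumes "0 < \<alpha>" "holder_on \<alpha> {0..1} \<phi>"
  shows "bdd_above ((\<lambda>\<mu>. integral\<^sup>L \<mu> \<phi>) ` invariant_measures T)"
proof -
  obtain B where B: "\<And>x. x \<in> {0..1} \<Longrightarrow> \<bar>\<phi> x\<bar> \<le> B"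
    using holder_on_bounded[OF assms] by blast
  have B0: "0 \<le> B" using B[of 0] by simp
  show ?thesis
  proof (rule bdd_aboveI2)
    fix \<mu> assume mu: "\<mu> \<in> invariant_measures T"
    then have sp: "space \<mu> = {0..1}"
      using sets_eq_imp_space_eq[of \<mu> borel_I]
      by (auto simp: invariant_measures_def space_restrict_space)
    interpret prob_space \<mu>
      using mu by (simp add: invariant_measures_def)
    have "AE x in \<mu>. \<phi> x \<le> B"
      using B by (intro AE_I2) (simp add: sp abs_le_iff)
    then show "integral\<^sup>L \<mu> \<phi> \<le> B"
      using B0 integral_le_const[of \<phi> B] not_integrable_integral_eq[of \<mu> \<phi>]
      by (cases "integrable \<mu> \<phi>") auto
  qed
qed

end

theory Submission
  imports Defs
begin

text \<open>Let \<open>g = \<phi> - Q\<close> and let \<open>L f x = sup\<^sub>n (g + f) (1 / (n + x))\<close>. In a suitable metric the inverse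
  branches of the Gauss map contract uniformly, so \<open>L\<close> preserves a class of functions with a fixed
  Hoelder constant \<open>M\<close>. The iterates \<open>v\<^sub>k = L\<^sup>k 0\<close> stay in \<open>[-M, M]\<close>: integrating
  \<open>L f (G x) \<ge> g x + f x\<close> against invariant measures that nearly attain \<open>Q\<close> bounds them from
  below, and the periodic point of each composition of branches carries an invariant measure, which
  bounds the Birkhoff sums, and hence \<open>v\<^sub>k\<close>, from above. Since \<open>L\<close> commutes with suprema, the
  decreasing sequence \<open>w\<^sub>k = sup\<^sub>j\<^sub>\<ge>\<^sub>k v\<^sub>j\<close> satisfies \<open>L w\<^sub>k = w\<^sub>k\<^sub>+\<^sub>1\<close>, and its limit is the required
  fixed point of \<open>L\<close>.\<close>

section \<open>Inverse branches of the Gauss map and a metric they contract\<close>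

definition branch :: "nat \<Rightarrow> real \<Rightarrow> real" where
  "branch n x = 1 / (real n + x)"

lemma branch_in_I: "1 \<le> n \<Longrightarrow> x \<in> {0..1} \<Longrightarrow> branch n x \<in> {0..1}"
  by (auto simp: branch_def divide_simps)

lemma branch_pos: "1 \<le> n \<Longrightarrow> x \<in> {0..1} \<Longrightarrow> 0 < branch n x"
  by (auto simp: branch_def divide_simps)

lemma branch_less_one: "1 \<le> n \<Longrightarrow> 0 < x \<Longrightarrow> branch n x < 1"
  by (auto simp: branch_def divide_simps)

text \<open>The endpoint 1 is left out because \<open>branch n 1\<close> equals
  \<open>branch (Suc n) 0\<close>, which \<open>gauss_map\<close> sends to 0.\<close>

lemma gauss_map_branch:
  assumes "1 \<le> n" "0 \<le> x" "x < 1"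
  shows "gauss_map (branch n x) = x"
proof -
  have "\<lfloor>real n + x\<rfloor> = int n"
    using assms by linarith
  then show ?thesis
    using assms by (simp add: gauss_map_def branch_def)
qed

lemma branch_gauss_map:
  assumes "0 < x" "x \<le> 1"
  obtains n where "1 \<le> n" "branch n (gauss_map x) = x"
proof
  have "1 \<le> 1 / x" using assms by simp
  then have fl: "1 \<le> \<lfloor>1 / x\<rfloor>" by linarith
  then show "1 \<le> nat \<lfloor>1 / x\<rfloor>" by linarith
  have "real (nat \<lfloor>1 / x\<rfloor>) = of_int \<lfloor>1 / x\<rfloor>" using fl by linarith
  then show "branch (nat \<lfloor>1 / x\<rfloor>) (gauss_map x) = x"
    using assms by (simp add: branch_def gauss_map_def)
qed

text \<open>The Gauss map has derivative \<open>-1\<close> at \<open>1\<close>, so its branches do not contract the Euclidean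
  metric uniformly; they do contract this equivalent one.\<close>

definition gdist :: "real \<Rightarrow> real \<Rightarrow> real" where
  "gdist x y = \<bar>x - y\<bar> / ((1 + x) * (1 + y))"

lemma gdist_nonneg: "x \<in> {0..1} \<Longrightarrow> y \<in> {0..1} \<Longrightarrow> 0 \<le> gdist x y"
  by (auto simp: gdist_def)

lemma gdist_le:
  assumes "x \<in> {0..1}" "y \<in> {0..1}"
  shows "gdist x y \<le> \<bar>x - y\<bar>"
proof -
  have "1 * 1 \<le> (1 + x) * (1 + y)" using assms by (intro mult_mono) auto
  then show ?thesis unfolding gdist_def
    using divide_left_mono[of 1 "(1 + x) * (1 + y)" "\<bar>x - y\<bar>"] by simp
qed

lemma gdist_ge:
  assumes "x \<in> {0..1}" "y \<in> {0..1}"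
  shows "\<bar>x - y\<bar> \<le> 4 * gdist x y"
proof -
  have "(1 + x) * (1 + y) \<le> 2 * 2" using assms by (intro mult_mono) auto
  moreover have "0 < (1 + x) * (1 + y)" using assms by auto
  ultimately show ?thesis unfolding gdist_def
    using divide_left_mono[of "(1 + x) * (1 + y)" 4 "\<bar>x - y\<bar>"] by (simp add: mult.commute)
qed

text \<open>Since \<open>1 + branch n x\<close> is (n + 1 + x) / (n + x), the denominators n + x and
  n + y cancel. Comparing what remains with \<open>gdist x y\<close> costs a factor (1 + z) / (n + 1
  + z) for each of the two points, which is largest at n = z = 1, with value 2/3.\<close>

lemma gdist_branch:
  assumes "1 \<le> n" "x \<in> {0..1}" "y \<in> {0..1}"
  shows "gdist (branch n x) (branch n y) \<le> 4/9 * gdist x y"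
proof -
  have pos: "0 < real n + x" "0 < real n + y" "0 < 1 + x" "0 < 1 + y" using assms by auto
  have *: "1 / (real n + 1 + z) \<le> 2/3 * (1 / (1 + z))" if "z \<in> {0..1}" for z
  proof -
    have "1 / (real n + 1 + z) \<le> 1 / (2 + z)" using that assms by (intro divide_left_mono) auto
    also have "\<dots> \<le> 2/3 * (1 / (1 + z))" using that by (auto simp: field_simps)
    finally show ?thesis .
  qed
  have d: "branch n x - branch n y = (y - x) / ((real n + x) * (real n + y))"
    using pos by (simp add: branch_def field_simps)
  have p: "1 + branch n x = (real n + 1 + x) / (real n + x)"
    "1 + branch n y = (real n + 1 + y) / (real n + y)"
    using pos by (simp_all add: branch_def field_simps)
  have "gdist (branch n x) (branch n y)
      = \<bar>x - y\<bar> * ((1 / (real n + 1 + x)) * (1 / (real n + 1 + y)))"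
    unfolding gdist_def d p using pos by (simp add: abs_mult abs_minus_commute)
  also have "\<dots> \<le> \<bar>x - y\<bar> * ((2/3 * (1 / (1 + x))) * (2/3 * (1 / (1 + y))))"
    (is "_ \<le> ?r") using pos assms by (intro mult_left_mono mult_mono *) auto
  also have "?r = (2/3 * (2/3)) * (\<bar>x - y\<bar> * ((1 / (1 + x)) * (1 / (1 + y))))"
    by (simp only: mult_ac)
  also have "\<dots> = 4/9 * gdist x y"
    by (simp add: gdist_def)
  finally show ?thesis .
qed

section \<open>Hoelder functions with respect to the contracted metric\<close>

text \<open>By symmetry of \<open>gdist\<close> the one-sided bound is equivalent to the two-sided
  one, and it passes directly to suprema and infima. The constant is explicit because all iterates
  must share one.\<close>

definition gholder :: "real \<Rightarrow> real \<Rightarrow> (real \<Rightarrow> real) \<Rightarrow> bool" where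
  "gholder \<alpha> M f \<longleftrightarrow> 0 \<le> M \<and> (\<forall>x\<in>{0..1}. \<forall>y\<in>{0..1}. f x \<le> f y + M * gdist x y powr \<alpha>)"

lemma gholderD: "gholder \<alpha> M f \<Longrightarrow> x \<in> {0..1} \<Longrightarrow> y \<in> {0..1} \<Longrightarrow> f x \<le> f y + M * gdist x y powr \<alpha>"
  by (auto simp: gholder_def)

lemma gdist_commute: "gdist x y = gdist y x"
  by (simp add: gdist_def abs_minus_commute mult.commute)

lemma holder_on_iff_gholder:
  assumes "0 < \<alpha>"
  shows "holder_on \<alpha> {0..1} f \<longleftrightarrow> (\<exists>M. gholder \<alpha> M f)"
proof
  assume "holder_on \<alpha> {0..1} f"
  then obtain C where C: "C \<ge> 0"
    "\<And>x y. x \<in> {0..1} \<Longrightarrow> y \<in> {0..1} \<Longrightarrow> \<bar>f x - f y\<bar> \<le> C * \<bar>x - y\<bar> powr \<alpha>"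
    unfolding holder_on_def by blast
  have "f x \<le> f y + (C * 4 powr \<alpha>) * gdist x y powr \<alpha>" if "x \<in> {0..1}" "y \<in> {0..1}" for x y
  proof -
    have "C * \<bar>x - y\<bar> powr \<alpha> \<le> C * (4 * gdist x y) powr \<alpha>"
      using C(1) gdist_ge[OF that] assms by (intro mult_left_mono powr_mono2) auto
    also have "\<dots> = (C * 4 powr \<alpha>) * gdist x y powr \<alpha>"
      using gdist_nonneg[OF that] by (simp add: powr_mult)
    finally show ?thesis using C(2)[OF that] by linarith
  qed
  then show "\<exists>M. gholder \<alpha> M f"
    using C(1) by (auto simp: gholder_def intro!: exI[of _ "C * 4 powr \<alpha>"])
next
  assume "\<exists>M. gholder \<alpha> M f"
  then obtain M where M: "gholder \<alpha> M f" ..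
  show "holder_on \<alpha> {0..1} f"
    unfolding holder_on_def
  proof (intro exI[of _ M] conjI ballI)
    show M0: "0 \<le> M" using M by (simp add: gholder_def)
    fix x y :: real assume xy: "x \<in> {0..1}" "y \<in> {0..1}"
    have "M * gdist x y powr \<alpha> \<le> M * \<bar>x - y\<bar> powr \<alpha>"
      using gdist_le[OF xy] gdist_nonneg[OF xy] assms M0
      by (intro mult_left_mono powr_mono2) auto
    then show "\<bar>f x - f y\<bar> \<le> M * \<bar>x - y\<bar> powr \<alpha>"
      using gholderD[OF M xy] gholderD[OF M xy(2,1)] by (simp add: gdist_commute[of y x])
  qed
qed

lemma gholder_continuous_on:
  assumes "0 < \<alpha>" "gholder \<alpha> M f"
  shows "continuous_on {0..1} f"
  unfolding continuous_on_def
proof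
  fix x :: real assume x: "x \<in> {0..1}"
  obtain C where C: "\<And>x y. x \<in> {0..1} \<Longrightarrow> y \<in> {0..1} \<Longrightarrow> \<bar>f x - f y\<bar> \<le> C * \<bar>x - y\<bar> powr \<alpha>"
    using assms holder_on_iff_gholder unfolding holder_on_def by meson
  have "((\<lambda>y. C * \<bar>y - x\<bar> powr \<alpha>) \<longlongrightarrow> C * 0) (at x within {0..1})"
    using assms(1)
    by (intro tendsto_mult tendsto_const tendsto_zero_powrI[where b=\<alpha>] tendsto_rabs_zero LIM_zero
        tendsto_ident_at) auto
  then have null: "((\<lambda>y. C * \<bar>y - x\<bar> powr \<alpha>) \<longlongrightarrow> 0) (at x within {0..1})"
    by simp
  have "\<forall>\<^sub>F y in at x within {0..1}. norm (f y - f x) \<le> C * \<bar>y - x\<bar> powr \<alpha>"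
    unfolding eventually_at_filter using C[OF _ x] by (intro always_eventually) simp
  then have "((\<lambda>y. f y - f x) \<longlongrightarrow> 0) (at x within {0..1})"
    using null by (rule Lim_null_comparison)
  then show "(f \<longlongrightarrow> f x) (at x within {0..1})"
    by (rule LIM_zero_cancel)
qed

text \<open>\<open>gdist\<close> is at most 1 on the unit interval. This turns a bound at one point,
  or on an average, into a bound everywhere.\<close>

lemma gholder_oscillation:
  assumes "0 < \<alpha>" "gholder \<alpha> M f" "x \<in> {0..1}" "y \<in> {0..1}"
  shows "f x \<le> f y + M"
proof -
  have "gdist x y powr \<alpha> \<le> 1 powr \<alpha>"
    using gdist_le[OF assms(3,4)] gdist_nonneg[OF assms(3,4)] assms
    by (intro powr_mono2) auto
  then have "M * gdist x y powr \<alpha> \<le> M * 1"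
    using assms(2) by (intro mult_left_mono) (auto simp: gholder_def)
  then show ?thesis using gholderD[OF assms(2-4)] by linarith
qed

lemma gholder_compose_branch:
  assumes "0 < \<alpha>" "gholder \<alpha> A g" "gholder \<alpha> B f" "1 \<le> n"
  shows "gholder \<alpha> ((4/9) powr \<alpha> * (A + B)) (\<lambda>x. g (branch n x) + f (branch n x))"
  unfolding gholder_def
proof (intro conjI ballI)
  have AB: "0 \<le> A" "0 \<le> B" using assms by (auto simp: gholder_def)
  then show "0 \<le> (4/9) powr \<alpha> * (A + B)" by simp
  fix x y :: real assume xy: "x \<in> {0..1}" "y \<in> {0..1}"
  have bxy: "branch n x \<in> {0..1}" "branch n y \<in> {0..1}"
    using branch_in_I assms(4) xy by auto
  have "gdist (branch n x) (branch n y) powr \<alpha> \<le> (4/9 * gdist x y) powr \<alpha>"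
    using gdist_branch[OF assms(4) xy] gdist_nonneg[OF bxy] assms(1) by (intro powr_mono2) auto
  also have "\<dots> = (4/9) powr \<alpha> * gdist x y powr \<alpha>"
    using gdist_nonneg[OF xy] by (subst powr_mult) auto
  finally have "(A + B) * gdist (branch n x) (branch n y) powr \<alpha>
      \<le> (A + B) * ((4/9) powr \<alpha> * gdist x y powr \<alpha>)"
    using AB by (intro mult_left_mono) auto
  then show "g (branch n x) + f (branch n x)
      \<le> g (branch n y) + f (branch n y) + (4/9) powr \<alpha> * (A + B) * gdist x y powr \<alpha>"
    using gholderD[OF assms(2) bxy] gholderD[OF assms(3) bxy] by (simp add: algebra_simps)
qed

section \<open>The Bellman operator\<close>

definition bellman :: "(real \<Rightarrow> real) \<Rightarrow> (real \<Rightarrow> real) \<Rightarrow> real \<Rightarrow> real" where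
  "bellman g f x = (SUP n\<in>{1::nat..}. g (branch n x) + f (branch n x))"

text \<open>A real supremum dominates its terms once they are bounded above; comparison with the
  values at 0 gives a bound uniform in n.\<close>

lemma bellman_upper:
  assumes "0 < \<alpha>" "gholder \<alpha> A g" "gholder \<alpha> B f" "1 \<le> n" "x \<in> {0..1}"
  shows "g (branch n x) + f (branch n x) \<le> bellman g f x"
  unfolding bellman_def
proof (rule cSUP_upper)
  show "bdd_above ((\<lambda>n. g (branch n x) + f (branch n x)) ` {1..})"
  proof (rule bdd_aboveI2)
    fix m :: nat assume "m \<in> {1..}"
    then have "branch m x \<in> {0..1}" using branch_in_I assms(5) by auto
    then show "g (branch m x) + f (branch m x) \<le> (g 0 + A) + (f 0 + B)"
      using gholder_oscillation[OF assms(1,2), of "branch m x" 0]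
        gholder_oscillation[OF assms(1,3), of "branch m x" 0] by (intro add_mono) auto
  qed
qed (use assms in auto)

lemma bellman_least:
  assumes "\<And>n. 1 \<le> n \<Longrightarrow> g (branch n x) + f (branch n x) \<le> b"
  shows "bellman g f x \<le> b"
  unfolding bellman_def by (rule cSUP_least) (use assms in auto)

lemma gholder_bellman:
  assumes "0 < \<alpha>" "gholder \<alpha> A g" "gholder \<alpha> B f"
  shows "gholder \<alpha> ((4/9) powr \<alpha> * (A + B)) (bellman g f)"
  unfolding gholder_def
proof (intro conjI ballI bellman_least)
  show "0 \<le> (4/9) powr \<alpha> * (A + B)" using assms by (auto simp: gholder_def)
  fix x y :: real and n :: nat assume xy: "x \<in> {0..1}" "y \<in> {0..1}" and n: "1 \<le> n"
  show "g (branch n x) + f (branch n x)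
      \<le> bellman g f y + (4/9) powr \<alpha> * (A + B) * gdist x y powr \<alpha>"
    using gholderD[OF gholder_compose_branch[OF assms n] xy] bellman_upper[OF assms n xy(2)]
    by linarith
qed

text \<open>At the point \<open>0\<close>, which is in the image of no branch, the inequality is obtained as a limit
  along the points \<open>branch n 0\<close>.\<close>

lemma bellman_gauss_map:
  assumes "0 < \<alpha>" "gholder \<alpha> A g" "gholder \<alpha> B f" "x \<in> {0..1}"
  shows "g x + f x \<le> bellman g f (gauss_map x)"
proof (cases "x = 0")
  case False
  then obtain n where "1 \<le> n" "branch n (gauss_map x) = x"
    using branch_gauss_map[of x] assms(4) by auto
  then show ?thesis
    using bellman_upper[OF assms(1-3), of n "gauss_map x"] gauss_map_in_I by simp
next
  case True
  have lim: "(\<lambda>n. branch (Suc n) 0) \<longlonglongrightarrow> 0"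
    using LIMSEQ_inverse_real_of_nat by (simp add: branch_def inverse_eq_divide)
  have I: "branch (Suc n) 0 \<in> {0..1}" for n
    by (rule branch_in_I) auto
  have "continuous_on {0..1} (\<lambda>x. g x + f x)"
    using gholder_continuous_on assms(1-3) by (intro continuous_on_add) auto
  then have "(\<lambda>n. g (branch (Suc n) 0) + f (branch (Suc n) 0)) \<longlonglongrightarrow> g 0 + f 0"
    using lim I by (intro continuous_on_tendsto_compose[of "{0..1}" "\<lambda>x. g x + f x"]) auto
  then have "g 0 + f 0 \<le> bellman g f 0"
    by (rule LIMSEQ_le_const2) (use bellman_upper[OF assms(1-3)] in auto)
  then show ?thesis using True by (simp add: gauss_map_def)
qed

subsection \<open>Invariant measures\<close>

lemma invariant_measure_space:
  assumes "\<mu> \<in> invariant_measures T"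
  shows "space \<mu> = {0..1}"
  using assms sets_eq_imp_space_eq[of \<mu> borel_I]
  by (auto simp: invariant_measures_def space_restrict_space)

lemma invariant_measure_integrable:
  fixes f :: "real \<Rightarrow> real"
  assumes "\<mu> \<in> invariant_measures T" "continuous_on {0..1} f"
  shows "integrable \<mu> f"
proof -
  interpret prob_space \<mu> using assms by (simp add: invariant_measures_def)
  have "bounded (f ` {0..1})"
    using assms(2) by (intro compact_imp_bounded compact_continuous_image) auto
  then obtain B where B: "\<And>x. x \<in> {0..1} \<Longrightarrow> norm (f x) \<le> B"
    unfolding bounded_iff by blast
  have "f \<in> borel_measurable borel_I"
    using assms(2) by (rule borel_measurable_continuous_on_restrict)
  then have "f \<in> borel_measurable \<mu>"
    using assms(1) measurable_cong_sets[of \<mu> borel_I borel borel]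
    by (auto simp: invariant_measures_def)
  then show ?thesis
    using B invariant_measure_space[OF assms(1)]
    by (intro integrable_const_bound[of _ B] AE_I2) auto
qed

lemma invariant_measure_integral_comp:
  fixes f :: "real \<Rightarrow> real"
  assumes "\<mu> \<in> invariant_measures T" "continuous_on {0..1} f"
  shows "integrable \<mu> (\<lambda>x. f (T x))" "(\<integral>x. f (T x) \<partial>\<mu>) = integral\<^sup>L \<mu> f"
proof -
  have T: "T \<in> measurable \<mu> \<mu>" and d: "distr \<mu> \<mu> T = \<mu>"
    using assms by (auto simp: invariant_measures_def)
  have f: "integrable \<mu> f" by (rule invariant_measure_integrable[OF assms])
  show "integrable \<mu> (\<lambda>x. f (T x))"
    using f by (intro integrable_distr[OF T]) (simp add: d)
  show "(\<integral>x. f (T x) \<partial>\<mu>) = integral\<^sup>L \<mu> f"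
    using integral_distr[OF T, of f] borel_measurable_integrable[OF f] by (simp add: d)
qed

text \<open>Integrate \<open>bellman_gauss_map\<close>; invariance of the measure removes the
  composition with \<open>gauss_map\<close>.\<close>

lemma integral_bellman_ge:
  assumes "0 < \<alpha>" "gholder \<alpha> A g" "gholder \<alpha> B f" "\<mu> \<in> invariant_measures gauss_map"
  shows "integral\<^sup>L \<mu> g + integral\<^sup>L \<mu> f \<le> integral\<^sup>L \<mu> (bellman g f)"
proof -
  note cont = gholder_continuous_on[OF assms(1)]
  note cL = cont[OF gholder_bellman[OF assms(1-3)]]
  note int = invariant_measure_integrable[OF assms(4)]
  have "integral\<^sup>L \<mu> g + integral\<^sup>L \<mu> f = (\<integral>x. g x + f x \<partial>\<mu>)"
    using int[OF cont[OF assms(2)]] int[OF cont[OF assms(3)]] by simp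
  also have "\<dots> \<le> (\<integral>x. bellman g f (gauss_map x) \<partial>\<mu>)"
    using int[OF cont[OF assms(2)]] int[OF cont[OF assms(3)]]
      invariant_measure_integral_comp(1)[OF assms(4) cL] bellman_gauss_map[OF assms(1-3)]
      invariant_measure_space[OF assms(4)]
    by (intro integral_mono) auto
  also have "\<dots> = integral\<^sup>L \<mu> (bellman g f)"
    by (rule invariant_measure_integral_comp(2)[OF assms(4) cL])
  finally show ?thesis .
qed

text \<open>The measure is the image of the uniform distribution on the indices below k. Using
  indices instead of orbit points lets k be any period, not just the minimal one.\<close>

lemma periodic_orbit_measure:
  fixes T :: "real \<Rightarrow> real" and f :: "real \<Rightarrow> real"
  assumes T: "T \<in> measurable borel_I borel_I" and x: "x \<in> {0..1}"
    and k: "0 < k" and per: "(T ^^ k) x = x" and f: "f \<in> borel_measurable borel_I"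
  obtains \<mu> where "\<mu> \<in> invariant_measures T" "integral\<^sup>L \<mu> f = (\<Sum>j<k. f ((T ^^ j) x)) / k"
proof -
  define p where "p = pmf_of_set {..<k}"
  define \<mu> where "\<mu> = distr (measure_pmf p) borel_I (\<lambda>j. (T ^^ j) x)"
  have sp: "space borel_I = {0..1}" by (simp add: space_restrict_space)
  have orb: "(T ^^ j) x \<in> {0..1}" for j
    using x measurable_space[OF T] sp by (induction j) auto
  then have m: "(\<lambda>j. (T ^^ j) x) \<in> measurable (measure_pmf p) borel_I"
    by (simp add: sp)
  \<comment> \<open>On indices, T acts as the cyclic shift, and a bijection preserves the uniform
    distribution.\<close>
  have "bij_betw (\<lambda>j. Suc j mod k) {..<k} {..<k}"
    unfolding bij_betw_def
  proof
    show inj: "inj_on (\<lambda>j. Suc j mod k) {..<k}"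
      by (auto simp: inj_on_def mod_Suc split: if_splits)
    show "(\<lambda>j. Suc j mod k) ` {..<k} = {..<k}"
      using k by (intro endo_inj_surj inj) auto
  qed
  then have "map_pmf (\<lambda>j. Suc j mod k) p = p"
    unfolding p_def using k by (intro map_pmf_of_set_bij_betw) auto
  then have shift: "distr (measure_pmf p) (count_space UNIV) (\<lambda>j. Suc j mod k) = measure_pmf p"
    by (simp flip: map_pmf_rep_eq)
  have Tmu: "T \<in> measurable \<mu> \<mu>"
    using T measurable_cong_sets[of \<mu> borel_I \<mu> borel_I] by (simp add: \<mu>_def)
  have "distr \<mu> \<mu> T = distr \<mu> borel_I T"
    by (rule distr_cong) (simp_all add: \<mu>_def)
  also have "\<dots> = distr (measure_pmf p) borel_I (T \<circ> (\<lambda>j. (T ^^ j) x))"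
    unfolding \<mu>_def by (rule distr_distr[OF T m])
  also have "T \<circ> (\<lambda>j. (T ^^ j) x) = (\<lambda>j. (T ^^ j) x) \<circ> (\<lambda>j. Suc j mod k)"
    by (simp add: fun_eq_iff funpow_mod_eq[OF per])
  also have "distr (measure_pmf p) borel_I \<dots>
      = distr (distr (measure_pmf p) (count_space UNIV) (\<lambda>j. Suc j mod k)) borel_I (\<lambda>j. (T ^^ j) x)"
    using orb by (intro distr_distr[symmetric]) (auto simp: sp)
  also have "\<dots> = \<mu>" unfolding shift \<mu>_def ..
  finally have "\<mu> \<in> invariant_measures T"
    using Tmu prob_space.prob_space_distr[OF prob_space_measure_pmf m]
    by (simp add: invariant_measures_def \<mu>_def)
  moreover have "integral\<^sup>L \<mu> f = (\<Sum>j<k. f ((T ^^ j) x)) / k"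
    unfolding \<mu>_def p_def using integral_distr[OF m f] k
    by (subst integral_distr[OF m[unfolded p_def] f], subst integral_pmf_of_set) auto
  ultimately show ?thesis by (rule that)
qed

subsection \<open>Periodic orbits of the Gauss map\<close>

text \<open>The head of the word is applied first, so the Gauss map undoes the letters from the last
  to the first.\<close>

fun word_map :: "nat list \<Rightarrow> real \<Rightarrow> real" where
  "word_map [] x = x"
| "word_map (n # ns) x = word_map ns (branch n x)"

fun word_sum :: "(real \<Rightarrow> real) \<Rightarrow> nat list \<Rightarrow> real \<Rightarrow> real" where
  "word_sum g [] x = 0"
| "word_sum g (n # ns) x = g (branch n x) + word_sum g ns (branch n x)"

lemma word_map_in_I: "\<forall>n\<in>set ns. 1 \<le> n \<Longrightarrow> x \<in> {0..1} \<Longrightarrow> word_map ns x \<in> {0..1}"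
  by (induction ns arbitrary: x) (use branch_in_I in auto)

lemma word_map_pos:
  "\<forall>n\<in>set ns. 1 \<le> n \<Longrightarrow> x \<in> {0..1} \<Longrightarrow> 0 < x \<or> ns \<noteq> [] \<Longrightarrow> 0 < word_map ns x"
proof (induction ns arbitrary: x)
  case (Cons n ns)
  then show ?case using branch_pos[of n x] branch_in_I[of n x] by simp
qed simp

lemma word_map_less_one:
  "\<forall>n\<in>set ns. 1 \<le> n \<Longrightarrow> 0 < x \<Longrightarrow> x \<le> 1 \<Longrightarrow> x < 1 \<or> ns \<noteq> [] \<Longrightarrow> word_map ns x < 1"
proof (induction ns arbitrary: x)
  case (Cons n ns)
  then show ?case using branch_pos[of n x] branch_less_one[of n x] by simp
qed simp

lemma continuous_on_word_map:
  "\<forall>n\<in>set ns. 1 \<le> n \<Longrightarrow> continuous_on {0..1} (word_map ns)"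
proof (induction ns)
  case (Cons n ns)
  have "continuous_on {0..1} (branch n)"
    unfolding branch_def using Cons.prems by (intro continuous_intros) auto
  moreover have "branch n ` {0..1} \<subseteq> {0..1}"
    using Cons.prems branch_in_I by auto
  ultimately have "continuous_on {0..1} (\<lambda>x. word_map ns (branch n x))"
    using Cons by (auto intro: continuous_on_compose2[of "{0..1}" "word_map ns"])
  then show ?case by simp
qed simp

text \<open>\<open>word_sum\<close> is a Birkhoff sum read backwards. In the induction the first
  conjunct identifies the new last point of the orbit, of index \<open>length ns\<close>, as
  \<open>branch n x\<close>. The open interval is preserved by the branches and avoids the endpoint
  at which \<open>gauss_map\<close> fails to invert them.\<close>

lemma word_sum_gauss_orbit:
  assumes "\<forall>n\<in>set ns. 1 \<le> n" "0 < x" "x < 1"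
  shows "(gauss_map ^^ length ns) (word_map ns x) = x \<and>
    word_sum g ns x = (\<Sum>j<length ns. g ((gauss_map ^^ j) (word_map ns x)))"
  using assms
proof (induction ns arbitrary: x)
  case (Cons n ns)
  have "0 < branch n x" "branch n x < 1"
    using Cons.prems branch_pos[of n x] branch_less_one[of n x] by auto
  then show ?case
    using Cons.IH[of "branch n x"] Cons.prems gauss_map_branch[of n x] by simp
qed simp

text \<open>Brouwer's theorem gives a fixed point in the closed interval. A nonempty word has
  positive values, so the fixed point is positive, and it maps positive points below 1.\<close>

lemma word_periodic_point:
  assumes "\<forall>n\<in>set ns. 1 \<le> n" "ns \<noteq> []"
  obtains x where "0 < x" "x < 1" "word_map ns x = x"
proof -
  obtain x where x: "x \<in> {0..1}" "word_map ns x = x"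
    using brouwer[of "{0..1::real}" "word_map ns"] continuous_on_word_map[OF assms(1)]
      word_map_in_I[OF assms(1)] by auto
  have "0 < x" using word_map_pos[OF assms(1) x(1)] x(2) assms(2) by simp
  moreover have "x < 1" using word_map_less_one[OF assms(1), of x] calculation x assms(2) by simp
  ultimately show ?thesis using x(2) that by blast
qed

subsection \<open>Iterates of the Bellman operator\<close>

text \<open>The last two assumptions express that the integrals of g over invariant measures have
  supremum 0.\<close>

locale normalised_potential =
  fixes \<alpha> D :: real and g :: "real \<Rightarrow> real"
  assumes alpha: "0 < \<alpha>" and gholder_g: "gholder \<alpha> D g"
    and integral_nonpos: "\<And>\<mu>. \<mu> \<in> invariant_measures gauss_map \<Longrightarrow> integral\<^sup>L \<mu> g \<le> 0"
    and integral_approx: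
      "\<And>e. 0 < e \<Longrightarrow> \<exists>\<mu>\<in>invariant_measures gauss_map. - e < integral\<^sup>L \<mu> g"
begin

text \<open>The fixed point of m \<mapsto> (4/9)^\<alpha> (D + m), the map describing how
  \<open>bellman g\<close> changes a Hoelder constant.\<close>

definition M :: real where
  "M = (4/9) powr \<alpha> * D / (1 - (4/9) powr \<alpha>)"

lemma theta_less_one: "(4/9::real) powr \<alpha> < 1"
  using powr_less_mono2[of \<alpha> "4/9" 1] alpha by simp

lemma M_fixed: "(4/9) powr \<alpha> * (D + M) = M"
proof -
  define \<theta> where "\<theta> = (4/9::real) powr \<alpha>"
  have "1 - \<theta> \<noteq> 0" using theta_less_one unfolding \<theta>_def by linarith
  then have "\<theta> * (D + \<theta> * D / (1 - \<theta>)) = \<theta> * D / (1 - \<theta>)"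
    by (simp add: divide_simps) (simp add: algebra_simps)
  then show ?thesis by (simp add: M_def \<theta>_def)
qed

lemma M_nonneg: "0 \<le> M"
  using theta_less_one gholder_g by (simp add: M_def gholder_def)

lemma gholder_bellman_M: "gholder \<alpha> M f \<Longrightarrow> gholder \<alpha> M (bellman g f)"
  using gholder_bellman[OF alpha gholder_g] M_fixed by metis

definition iter :: "nat \<Rightarrow> real \<Rightarrow> real" where
  "iter k = (bellman g ^^ k) (\<lambda>_. 0)"

lemma iter_0: "iter 0 x = 0" and iter_Suc: "iter (Suc k) = bellman g (iter k)"
  by (simp_all add: iter_def)

lemma gholder_iter: "gholder \<alpha> M (iter k)"
proof (induction k)
  case 0
  show ?case using M_nonneg by (simp add: gholder_def iter_0)
next
  case (Suc k)
  then show ?case by (simp add: iter_Suc gholder_bellman_M)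
qed

lemma integral_iter_ge:
  assumes "\<mu> \<in> invariant_measures gauss_map"
  shows "k * integral\<^sup>L \<mu> g \<le> integral\<^sup>L \<mu> (iter k)"
proof (induction k)
  case 0
  show ?case by (simp add: iter_0)
next
  case (Suc k)
  then show ?case
    using integral_bellman_ge[OF alpha gholder_g gholder_iter assms, of k]
    by (simp add: iter_Suc algebra_simps)
qed

text \<open>For a nearly maximising measure the mean of \<open>iter k\<close> is at least -e, and
  any value differs from the mean by at most M.\<close>

lemma iter_ge:
  assumes x: "x \<in> {0..1}"
  shows "- M \<le> iter k x"
proof (rule field_le_epsilon)
  fix e :: real assume e: "0 < e"
  \<comment> \<open>The error is multiplied by k later; dividing by k + 1 also covers k = 0.\<close>
  then obtain \<mu> where mu: "\<mu> \<in> invariant_measures gauss_map"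
    and mu_e: "- (e / (k + 1)) < integral\<^sup>L \<mu> g"
    using integral_approx[of "e / (k + 1)"] by auto
  interpret prob_space \<mu> using mu by (simp add: invariant_measures_def)
  have "- e \<le> k * (- (e / (k + 1)))" using e by (simp add: field_simps)
  also have "\<dots> \<le> k * integral\<^sup>L \<mu> g" using mu_e by (intro mult_left_mono) auto
  also have "\<dots> \<le> integral\<^sup>L \<mu> (iter k)" by (rule integral_iter_ge[OF mu])
  also have "\<dots> \<le> iter k x + M"
    using gholder_oscillation[OF alpha gholder_iter _ x] invariant_measure_space[OF mu]
      invariant_measure_integrable[OF mu gholder_continuous_on[OF alpha gholder_iter]]
    by (intro integral_le_const AE_I2) auto
  finally show "- M \<le> iter k x + e" by simp
qed

text \<open>By \<open>M_fixed\<close> the constant does not grow with the length of the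
  word.\<close>

lemma gholder_word_sum:
  "\<forall>n\<in>set ns. 1 \<le> n \<Longrightarrow> gholder \<alpha> M (word_sum g ns)"
proof (induction ns)
  case Nil
  show ?case using M_nonneg by (simp add: gholder_def)
next
  case (Cons n ns)
  then show ?case
    using gholder_compose_branch[OF alpha gholder_g, of M "word_sum g ns" n] by (simp add: M_fixed)
qed

text \<open>At the periodic point the sum is the length times an integral of g against an invariant
  measure, hence nonpositive; moving to x costs at most M.\<close>

lemma word_sum_le:
  assumes ns: "\<forall>n\<in>set ns. 1 \<le> n" and x: "x \<in> {0..1}"
  shows "word_sum g ns x \<le> M"
proof (cases "ns = []")
  case True
  then show ?thesis by (simp add: M_nonneg)
next
  case False
  obtain y where y: "0 < y" "y < 1" "word_map ns y = y"
    using word_periodic_point[OF ns False] by blast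
  have "g \<in> borel_measurable borel_I"
    using gholder_continuous_on[OF alpha gholder_g]
    by (rule borel_measurable_continuous_on_restrict)
  then obtain \<mu> where "\<mu> \<in> invariant_measures gauss_map"
    "integral\<^sup>L \<mu> g = (\<Sum>j<length ns. g ((gauss_map ^^ j) y)) / length ns"
    using periodic_orbit_measure[OF gauss_map_measurable, of y "length ns" g]
      word_sum_gauss_orbit[OF ns y(1,2)] y False by auto
  then have "(\<Sum>j<length ns. g ((gauss_map ^^ j) y)) / length ns \<le> 0"
    using integral_nonpos by metis
  then have "word_sum g ns y \<le> 0"
    using word_sum_gauss_orbit[OF ns y(1,2), of g] y(3) False by (simp add: divide_le_0_iff)
  then show ?thesis
    using gholder_oscillation[OF alpha gholder_word_sum[OF ns] x, of y] y by simp
qed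

text \<open>Unfolding the nested suprema turns \<open>iter k x\<close> into a supremum over words of
  length k. The accumulator c holds the values of g already collected in the induction.\<close>

lemma iter_le_word_sums:
  assumes "\<And>ns. length ns = k \<Longrightarrow> \<forall>n\<in>set ns. 1 \<le> n \<Longrightarrow> c + word_sum g ns x \<le> b"
  shows "c + iter k x \<le> b"
  using assms
proof (induction k arbitrary: c x)
  case 0
  have "c + word_sum g [] x \<le> b" by (rule 0) simp_all
  then show ?case by (simp add: iter_0)
next
  case (Suc k)
  have "bellman g (iter k) x \<le> b - c"
  proof (rule bellman_least)
    fix n :: nat assume n: "1 \<le> n"
    have "(c + g (branch n x)) + iter k (branch n x) \<le> b"
    proof (rule Suc.IH)
      fix ns :: "nat list" assume "length ns = k" "\<forall>n\<in>set ns. 1 \<le> n"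
      then have "c + word_sum g (n # ns) x \<le> b"
        using n by (intro Suc.prems) simp_all
      then show "c + g (branch n x) + word_sum g ns (branch n x) \<le> b" by simp
    qed
    then show "g (branch n x) + iter k (branch n x) \<le> b - c" by simp
  qed
  then show ?case by (simp add: iter_Suc)
qed

lemma iter_le: "x \<in> {0..1} \<Longrightarrow> iter k x \<le> M"
  using iter_le_word_sums[of k 0 x M] word_sum_le[of _ x] by (metis add_0)

section \<open>The upper limit of the iterates and its fixed-point equation\<close>

definition tail_sup :: "nat \<Rightarrow> real \<Rightarrow> real" where
  "tail_sup k x = (SUP j\<in>{k..}. iter j x)"

lemma iter_le_tail_sup: "x \<in> {0..1} \<Longrightarrow> k \<le> j \<Longrightarrow> iter j x \<le> tail_sup k x"
  unfolding tail_sup_def using iter_le by (intro cSUP_upper bdd_aboveI2[where M=M]) auto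

lemma tail_sup_least: "(\<And>j. k \<le> j \<Longrightarrow> iter j x \<le> b) \<Longrightarrow> tail_sup k x \<le> b"
  unfolding tail_sup_def by (intro cSUP_least) auto

lemma tail_sup_antimono: "x \<in> {0..1} \<Longrightarrow> k \<le> l \<Longrightarrow> tail_sup l x \<le> tail_sup k x"
  by (intro tail_sup_least iter_le_tail_sup) auto

lemma tail_sup_ge: "x \<in> {0..1} \<Longrightarrow> - M \<le> tail_sup k x"
  using iter_ge iter_le_tail_sup[of x k k] order_trans by blast

lemma gholder_tail_sup: "gholder \<alpha> M (tail_sup k)"
  unfolding gholder_def
proof (intro conjI ballI M_nonneg tail_sup_least)
  fix x y :: real and j assume "x \<in> {0..1}" "y \<in> {0..1}" "k \<le> j"
  then show "iter j x \<le> tail_sup k y + M * gdist x y powr \<alpha>"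
    using gholderD[OF gholder_iter, of x y j] iter_le_tail_sup[of y k j] by linarith
qed

text \<open>The suprema over branches and over iterates commute; applying the operator raises each
  iterate's index by one.\<close>

lemma bellman_tail_sup:
  assumes x: "x \<in> {0..1}"
  shows "bellman g (tail_sup k) x = tail_sup (Suc k) x"
proof (rule antisym)
  show "bellman g (tail_sup k) x \<le> tail_sup (Suc k) x"
  proof (rule bellman_least)
    fix n :: nat assume n: "1 \<le> n"
    have "tail_sup k (branch n x) \<le> tail_sup (Suc k) x - g (branch n x)"
    proof (rule tail_sup_least)
      fix j assume "k \<le> j"
      then show "iter j (branch n x) \<le> tail_sup (Suc k) x - g (branch n x)"
        using bellman_upper[OF alpha gholder_g gholder_iter n x, of j]
          iter_le_tail_sup[OF x, of "Suc k" "Suc j"] by (simp add: iter_Suc)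
    qed
    then show "g (branch n x) + tail_sup k (branch n x) \<le> tail_sup (Suc k) x" by simp
  qed
  show "tail_sup (Suc k) x \<le> bellman g (tail_sup k) x"
  proof (rule tail_sup_least)
    fix j assume "Suc k \<le> j"
    then obtain i where i: "j = Suc i" "k \<le> i" by (cases j) auto
    show "iter j x \<le> bellman g (tail_sup k) x"
      unfolding i(1) iter_Suc
    proof (rule bellman_least)
      fix n :: nat assume n: "1 \<le> n"
      show "g (branch n x) + iter i (branch n x) \<le> bellman g (tail_sup k) x"
        using bellman_upper[OF alpha gholder_g gholder_tail_sup n x, of k]
          iter_le_tail_sup[OF branch_in_I[OF n x] i(2)] by linarith
    qed
  qed
qed

text \<open>This is the pointwise upper limit of \<open>iter k\<close>.\<close>

definition subaction :: "real \<Rightarrow> real" where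
  "subaction x = (INF k. tail_sup k x)"

lemma subaction_le: "x \<in> {0..1} \<Longrightarrow> subaction x \<le> tail_sup k x"
  unfolding subaction_def using tail_sup_ge by (intro cINF_lower bdd_belowI2[where m="-M"]) auto

lemma subaction_greatest: "(\<And>k. b \<le> tail_sup k x) \<Longrightarrow> b \<le> subaction x"
  unfolding subaction_def by (intro cINF_greatest) auto

lemma gholder_subaction: "gholder \<alpha> M subaction"
  unfolding gholder_def
proof (intro conjI ballI M_nonneg)
  fix x y :: real assume xy: "x \<in> {0..1}" "y \<in> {0..1}"
  have "subaction x - M * gdist x y powr \<alpha> \<le> subaction y"
  proof (rule subaction_greatest)
    fix k
    show "subaction x - M * gdist x y powr \<alpha> \<le> tail_sup k y"
      using gholderD[OF gholder_tail_sup xy, of k] subaction_le[OF xy(1), of k] by linarith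
  qed
  then show "subaction x \<le> subaction y + M * gdist x y powr \<alpha>" by simp
qed

text \<open>For the lower bound, near-maximisers for \<open>tail_sup k\<close> accumulate at a point \<open>y\<close> in the
  compact interval, which need not be of the form \<open>branch n x\<close>; continuity passes to the limit.\<close>

lemma bellman_subaction:
  assumes x: "x \<in> {0..1}"
  shows "bellman g subaction x = subaction x"
proof (rule antisym)
  show "bellman g subaction x \<le> subaction x"
  proof (intro bellman_least subaction_greatest)
    fix n k :: nat assume n: "1 \<le> n"
    show "g (branch n x) + subaction (branch n x) \<le> tail_sup k x"
      using bellman_upper[OF alpha gholder_g gholder_tail_sup n x, of k] bellman_tail_sup[OF x, of k]
        subaction_le[OF branch_in_I[OF n x], of k] tail_sup_antimono[OF x, of k "Suc k"] by linarith
  qed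
next
  \<comment> \<open>The slack allows for a supremum that is not attained. If every n failed,
    \<open>tail_sup (Suc k) x\<close> would fall strictly below \<open>subaction x\<close>.\<close>
  have "\<exists>n\<ge>1. subaction x - inverse (Suc k) < g (branch n x) + tail_sup k (branch n x)" for k
  proof (rule ccontr)
    assume "\<not> ?thesis"
    then have "bellman g (tail_sup k) x \<le> subaction x - inverse (Suc k)"
      by (intro bellman_least) (auto simp: not_less)
    moreover have "0 < inverse (real (Suc k))" by simp
    ultimately show False
      using subaction_le[OF x, of "Suc k"] bellman_tail_sup[OF x, of k] by linarith
  qed
  then obtain n where n: "\<And>k. 1 \<le> n k"
    and near: "\<And>k. subaction x - inverse (Suc k)
      < g (branch (n k) x) + tail_sup k (branch (n k) x)"
    by metis
  define z where "z k = branch (n k) x" for k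
  have z: "z k \<in> {0..1}" for k
    unfolding z_def using branch_in_I n x by blast
  obtain y r where y: "y \<in> {0..1}" and r: "strict_mono r" and lim: "(z \<circ> r) \<longlonglongrightarrow> y"
    using compact_imp_seq_compact[of "{0..1::real}"] z unfolding seq_compact_def by blast
  have conv: "(\<lambda>k. g (z (r k)) + f (z (r k))) \<longlonglongrightarrow> g y + f y" if "gholder \<alpha> M f" for f
  proof (rule continuous_on_tendsto_compose[where f="\<lambda>x. g x + f x"])
    show "continuous_on {0..1} (\<lambda>x. g x + f x)"
      using gholder_continuous_on[OF alpha that] gholder_continuous_on[OF alpha gholder_g]
      by (rule continuous_on_add[rotated])
    show "(\<lambda>k. z (r k)) \<longlonglongrightarrow> y" using lim by (simp add: o_def)
  qed (use y z in auto)
  have "subaction x - g y \<le> subaction y"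
  proof (rule subaction_greatest)
    fix k
    have "(\<lambda>i. subaction x - inverse (Suc (r i))) \<longlonglongrightarrow> subaction x - 0"
      using LIMSEQ_subseq_LIMSEQ[OF LIMSEQ_inverse_real_of_nat r]
      by (intro tendsto_diff tendsto_const) (simp add: o_def)
    \<comment> \<open>Both the function and the point vary in \<open>near\<close>. Monotonicity
      freezes the function at index k, so that its continuity applies.\<close>
    moreover have "\<exists>N. \<forall>i\<ge>N. subaction x - inverse (Suc (r i)) \<le> g (z (r i)) + tail_sup k (z (r i))"
    proof (intro exI[of _ k] allI impI)
      fix i assume "k \<le> i"
      then have "k \<le> r i" using seq_suble[OF r, of i] by linarith
      then show "subaction x - inverse (Suc (r i)) \<le> g (z (r i)) + tail_sup k (z (r i))"
        using near[of "r i"] tail_sup_antimono[OF z, of k "r i" "r i"] unfolding z_def by linarith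
    qed
    ultimately have "subaction x - 0 \<le> g y + tail_sup k y"
      using conv[OF gholder_tail_sup] by (intro LIMSEQ_le)
    then show "subaction x - g y \<le> tail_sup k y" by simp
  qed
  moreover have "g y + subaction y \<le> bellman g subaction x"
    using conv[OF gholder_subaction]
    by (rule LIMSEQ_le_const2)
       (use bellman_upper[OF alpha gholder_g gholder_subaction n x] in \<open>auto simp: z_def\<close>)
  ultimately show "subaction x \<le> bellman g subaction x" by linarith
qed

end

section \<open>Application to the normalised Hoelder potential\<close>

theorem theorem2:
  fixes \<alpha> :: real and \<phi> :: "real \<Rightarrow> real"
  assumes "0 < \<alpha>" and "\<alpha> \<le> 1"
    and "holder_on \<alpha> {0..1} \<phi>"
  shows "\<exists>u :: real \<Rightarrow> real. holder_on \<alpha> {0..1} u \<and>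
    (\<forall>x\<in>{0..1}. u x =
      (SUP n\<in>{1::nat..}. (\<phi> (1 / (real n + x)) - max_ergodic_average gauss_map \<phi>)
                            + u (1 / (real n + x))))"
proof -
  let ?Q = "max_ergodic_average gauss_map \<phi>"
  define g where "g = (\<lambda>x. \<phi> x - ?Q)"
  note bdd = integrals_bdd_above[OF assms(1,3), of gauss_map]
  obtain D where D: "gholder \<alpha> D \<phi>"
    using assms holder_on_iff_gholder by blast
  have int_g: "integral\<^sup>L \<mu> g = integral\<^sup>L \<mu> \<phi> - ?Q" if "\<mu> \<in> invariant_measures gauss_map" for \<mu>
  proof -
    interpret prob_space \<mu> using that by (simp add: invariant_measures_def)
    show ?thesis
      using invariant_measure_integrable[OF that gholder_continuous_on[OF assms(1) D]]
      by (simp add: g_def prob_space)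
  qed
  interpret normalised_potential \<alpha> D g
  proof
    show "0 < \<alpha>" by fact
    show "gholder \<alpha> D g" using D by (simp add: gholder_def g_def)
    fix \<mu> assume mu: "\<mu> \<in> invariant_measures gauss_map"
    show "integral\<^sup>L \<mu> g \<le> 0"
      using cSUP_upper[OF mu bdd] int_g[OF mu] by (simp add: max_ergodic_average_def)
  next
    fix e :: real assume "0 < e"
    \<comment> \<open>The set of integrals is nonempty and bounded above, so \<open>?Q\<close> is a
      true supremum and is approached by some measure.\<close>
    then have "?Q - e < (SUP \<mu>\<in>invariant_measures gauss_map. integral\<^sup>L \<mu> \<phi>)"
      by (simp add: max_ergodic_average_def)
    then obtain \<mu> where mu: "\<mu> \<in> invariant_measures gauss_map" "?Q - e < integral\<^sup>L \<mu> \<phi>"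
      using less_cSUP_iff[OF invariant_measures_gauss_nonempty bdd] by blast
    then show "\<exists>\<mu>\<in>invariant_measures gauss_map. - e < integral\<^sup>L \<mu> g"
      using int_g by (intro bexI[of _ \<mu>]) auto
  qed
  have "holder_on \<alpha> {0..1} subaction"
    using gholder_subaction holder_on_iff_gholder[OF assms(1)] by blast
  moreover have "subaction x = (SUP n\<in>{1::nat..}. (\<phi> (1 / (real n + x)) - ?Q)
      + subaction (1 / (real n + x)))" if "x \<in> {0..1}" for x
    using bellman_subaction[OF that] by (simp add: bellman_def g_def branch_def)
  ultimately show ?thesis by blast
qed

end
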